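(* Let $q\ge 2$ and $p\in(1,\infty)$. Let $C\subset\mathbb{R}^q$ be a closed, solid, pointed, nontrivial, polyhedral convex cone, let $X\subset\mathbb{R}^n$ be a nonempty compact convex set with $\operatorname{int}X\neq\emptyset$, and let $\Gamma:X\to\mathbb{R}^q$ be continuous and $C$-convex. Let $\mathcal{P}:=\Gamma(X)+C$ and let $A\subset\mathbb{R}^q$ be a compact convex slice of $\mathcal{P}$ with $\operatorname{int}A\neq\emptyset$, contained in an $\ell_p$-ball of radius $R>0$. Let $\{P_k\}_{k\ge0}$ be the (infinite) sequence of outer approximations of $A$ generated by the norm-minimization algorithm with $\|\cdot\|_p$ scalarization (described in the context). Then $$\delta_H(P_k,A;\|\cdot\|_p)=O\bigl(k^{2/(1-q)}\bigr)\quad\text{as }k\to\infty ,$$ that is, $\delta_H(P_k,A;\|\cdot\|_p)=O(k^{c(p)/(1-q)})$ with the exponent $c(p)=2$ for every $p\in(1,\infty)$. More precisely, for every $\varepsilon>0$ there exist $K\in\mathbb{N}$ and a constant $\Lambda=\Lambda(p,q,R,A)>0$, depending only on $p,q,R,A$, such that $$\delta_H(P_k,A;\|\cdot\|_p)\le(1+\varepsilon)\,\Lambda(p,q,R,A)\,k^{2/(1-q)}\quad\text{for all }k\ge K.$$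
   Context: $\|\cdot\|_p$ is the $\ell_p$ norm on $\mathbb{R}^q$, $p^*=p/(p-1)$, and $\langle\cdot,\cdot\rangle$ is the Euclidean inner product. A cone is solid if it has nonempty interior. Write $a\le_C b$ iff $b-a\in C$; $\Gamma$ is $C$-convex if $\Gamma(\lambda x+(1-\lambda)x')\le_C\lambda\Gamma(x)+(1-\lambda)\Gamma(x')$ for all $x,x'\in X$, $\lambda\in[0,1]$. Slice: $A=\mathcal{P}\cap\{y\in\mathbb{R}^q:\langle\bar w,y\rangle\le\gamma\}$ for some $\bar w\in\operatorname{int}C^+$ and $\gamma\in\mathbb{R}$, where $C^+=\{w:\langle w,c\rangle\ge0\ \forall c\in C\}$. Hausdorff distance of compact convex sets $A,B$: $\delta_H(A,B;\|\cdot\|_p)=\max\{\max_{a\in A}\min_{b\in B}\|a-b\|_p,\ \max_{b\in B}\min_{a\in A}\|a-b\|_p\}$. Norm-minimization algorithm with $\|\cdot\|_p$ scalarization: $P_0\supseteq A$ is a polytope (bounded) that is the intersection of finitely many supporting halfspaces of $A$. Given a polytope $P_k\supseteq A$ with vertex set $\operatorname{ext}(P_k)$, for each $v\in\operatorname{ext}(P_k)$ let $y^v:=\arg\min_{y\in A}\|y-v\|_p$ (unique) and $z^v:=y^v-v$. Choose $v^k\in\operatorname{ext}(P_k)$ maximizing $\|z^v\|_p$. If $z^{v^k}=0$, then $P_k=A$ and the procedure stops. Otherwise let $w^k:=\nabla\|\cdot\|_p(z^{v^k})$, i.e. $w^k_i=|z_i|^{p-1}\operatorname{sgn}(z_i)/\|z\|_p^{p-1}$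 with $z=z^{v^k}$ (so $\|w^k\|_{p^*}=1$), and set $$P_{k+1}:=P_k\cap\{y\in\mathbb{R}^q:\langle w^k,y\rangle\ge\langle w^k,y^{v^k}\rangle\},$$ where the last set is a halfspace containing $A$ and supporting $A$ at $y^{v^k}$. *)

theory Defs
  imports "HOL-Analysis.Analysis" "HOL-Library.Landau_Symbols"
begin

definition lp_norm :: "real \<Rightarrow> real ^ 'q \<Rightarrow> real" where
  "lp_norm p x = (\<Sum>i\<in>UNIV. \<bar>x $ i\<bar> powr p) powr (1 / p)"

text \<open>For nonempty compact sets the suprema and infima below are attained, so this is the
  usual max-min expression.\<close>

definition lp_hausdorff :: "real \<Rightarrow> (real ^ 'q) set \<Rightarrow> (real ^ 'q) set \<Rightarrow> real" where
  "lp_hausdorff p A B =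
     max (SUP a\<in>A. INF b\<in>B. lp_norm p (a - b)) (SUP b\<in>B. INF a\<in>A. lp_norm p (a - b))"

definition dual_cone :: "(real ^ 'q) set \<Rightarrow> (real ^ 'q) set" where
  "dual_cone C = {w. \<forall>c\<in>C. 0 \<le> w \<bullet> c}"

definition cone_le :: "(real ^ 'q) set \<Rightarrow> real ^ 'q \<Rightarrow> real ^ 'q \<Rightarrow> bool" where
  "cone_le C a b \<longleftrightarrow> b - a \<in> C"

definition ordering_cone :: "(real ^ 'q) set \<Rightarrow> bool" where
  "ordering_cone C \<longleftrightarrow>
     cone C \<and> convex C \<and> closed C \<and> polyhedron C \<and>
     interior C \<noteq> {} \<and>
     (\<forall>c. c \<in> C \<and> - c \<in> C \<longrightarrow> c = 0) \<and>
     C \<noteq> {0} \<and> C \<noteq> UNIV"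

text \<open>The decision space is Euclidean \<open>n\<close>-space for a variable \<open>n\<close>, represented by \<^const>\<open>Euclidean_space\<close>:
  its points are the functions \<^typ>\<open>nat \<Rightarrow> real\<close> vanishing at all indices from \<open>n\<close> on. Function
  spaces are not an instance of \<^class>\<open>real_vector\<close>, so convex combinations are written
  coordinatewise. Having \<open>n\<close> as a number rather than a type allows constants to be
  chosen independently of it.\<close>

definition lincomb :: "real \<Rightarrow> (nat \<Rightarrow> real) \<Rightarrow> (nat \<Rightarrow> real) \<Rightarrow> nat \<Rightarrow> real" where
  "lincomb l x x' = (\<lambda>i. l * x i + (1 - l) * x' i)"

definition feasible_set :: "nat \<Rightarrow> (nat \<Rightarrow> real) set \<Rightarrow> bool" where
  "feasible_set n X \<longleftrightarrow>
     X \<noteq> {} \<and> compactin (Euclidean_space n) X \<and>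
     (\<forall>x\<in>X. \<forall>x'\<in>X. \<forall>l\<in>{0..1}. lincomb l x x' \<in> X) \<and>
     Euclidean_space n interior_of X \<noteq> {}"

definition cone_convex_on ::
  "(real ^ 'q) set \<Rightarrow> (nat \<Rightarrow> real) set \<Rightarrow> ((nat \<Rightarrow> real) \<Rightarrow> real ^ 'q) \<Rightarrow> bool" where
  "cone_convex_on C X \<Gamma> \<longleftrightarrow>
     (\<forall>x\<in>X. \<forall>x'\<in>X. \<forall>l\<in>{0..1}.
        cone_le C (\<Gamma> (lincomb l x x')) (l *\<^sub>R \<Gamma> x + (1 - l) *\<^sub>R \<Gamma> x'))"

definition slice_of :: "(real ^ 'q) set \<Rightarrow> (real ^ 'q) set \<Rightarrow> (real ^ 'q) set \<Rightarrow> bool" where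
  "slice_of C \<P> A \<longleftrightarrow>
     (\<exists>w \<gamma>. w \<in> interior (dual_cone C) \<and> A = \<P> \<inter> {y. w \<bullet> y \<le> \<gamma>})"

definition supporting_halfspace :: "(real ^ 'q) set \<Rightarrow> (real ^ 'q) set \<Rightarrow> bool" where
  "supporting_halfspace A H \<longleftrightarrow>
     (\<exists>w b. w \<noteq> 0 \<and> H = {y. w \<bullet> y \<ge> b} \<and> A \<subseteq> H \<and> (\<exists>a\<in>A. w \<bullet> a = b))"

definition initial_outer_approx :: "(real ^ 'q) set \<Rightarrow> (real ^ 'q) set \<Rightarrow> bool" where
  "initial_outer_approx A P0 \<longleftrightarrow>
     polytope P0 \<and> A \<subseteq> P0 \<and>
     (\<exists>F. finite F \<and> (\<forall>H\<in>F. supporting_halfspace A H) \<and> P0 = \<Inter>F)"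

text \<open>For nonempty compact convex \<open>A\<close> and \<open>1 < p < \<infinity>\<close> the minimizer exists and is unique.\<close>

definition lp_proj :: "real \<Rightarrow> (real ^ 'q) set \<Rightarrow> real ^ 'q \<Rightarrow> real ^ 'q" where
  "lp_proj p A v = arg_min_on (\<lambda>y. lp_norm p (y - v)) A"

text \<open>The gradient of the \<open>p\<close>-norm at \<open>z \<noteq> 0\<close>. Zero coordinates of \<open>z\<close> contribute zero, since
  \<open>0 powr a = 0\<close>.\<close>

definition lp_grad :: "real \<Rightarrow> real ^ 'q \<Rightarrow> real ^ 'q" where
  "lp_grad p z = (\<chi> i. \<bar>z $ i\<bar> powr (p - 1) * sgn (z $ i) / lp_norm p z powr (p - 1))"

text \<open>\<open>P\<close> and \<open>v\<close> form a non-terminating run of the algorithm on \<open>A\<close>: \<open>P k\<close> is the \<open>k\<close>-th outer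
  approximation and \<open>v k\<close> the vertex selected in it. The choice among several maximizing vertices is
  left open.\<close>

definition norm_min_run ::
  "real \<Rightarrow> (real ^ 'q) set \<Rightarrow> (nat \<Rightarrow> (real ^ 'q) set) \<Rightarrow> (nat \<Rightarrow> real ^ 'q) \<Rightarrow> bool" where
  "norm_min_run p A P v \<longleftrightarrow>
     initial_outer_approx A (P 0) \<and>
     (\<forall>k. v k extreme_point_of P k \<and>
          (\<forall>u. u extreme_point_of P k \<longrightarrow>
               lp_norm p (lp_proj p A u - u) \<le> lp_norm p (lp_proj p A (v k) - v k)) \<and>
          lp_proj p A (v k) - v k \<noteq> 0 \<and>
          (let w = lp_grad p (lp_proj p A (v k) - v k)
           in P (Suc k) = P k \<inter> {y. w \<bullet> y \<ge> w \<bullet> lp_proj p A (v k)}))"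

end

theory Submission
  imports Defs
begin

text \<open>Let \<open>v j\<close> be the vertex chosen in step \<open>j\<close>, \<open>y j\<close> its projection onto \<open>A\<close> and \<open>h j\<close> its distance.
  By convexity of the distance, \<open>h j\<close> bounds the Hausdorff distance of \<open>P j\<close> and \<open>A\<close>, and \<open>h\<close> is
  decreasing. Thus it suffices to count how many steps can have \<open>h j \<ge> \<epsilon>\<close>.

  Let \<open>n j\<close> be the Euclidean unit normal obtained from the gradient of the \<open>p\<close>-norm; it is an inner
  normal of \<open>A\<close> at \<open>y j\<close> (\<open>lp_grad_supports\<close>). For \<open>i < j\<close> the vertex \<open>v j\<close> satisfies the cut made
  in step \<open>i\<close>. If \<open>n i\<close> and \<open>n j\<close> are close, this is possible only if \<open>y j\<close> lies at height at least
  of order \<open>h j\<close> above the supporting hyperplane at \<open>y i\<close>; otherwise the difference of the normals is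
  bounded below. Consequently the points \<open>y j - s n j\<close> with \<open>s \<ge> 1\<close>, which lie at distance \<open>s\<close> from \<open>A\<close>, have pairwise distances at least of order
  \<open>sqrt \<epsilon>\<close> for small \<open>\<epsilon>\<close> (\<open>deep_cuts_separated\<close>).

  These points lie on the boundary of a convex body, of dimension \<open>q - 1\<close>. A volume comparison of
  disjoint balls with a thin shell around \<open>A\<close> shows that at most of order \<open>(sqrt \<epsilon>) ^ (1 - q)\<close> of
  them fit (\<open>parallel_body_packing\<close>). Solving for \<open>\<epsilon>\<close> gives the rate \<open>k powr (2 / (1 - q))\<close>. The
  exponent does not see \<open>p\<close>: the separation argument is Euclidean, and \<open>p\<close> enters only through
  constants comparing the norms.\<close>

section \<open>The \<open>p\<close>-norm, its gradient and projections\<close>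

lemma lp_norm_nonneg: "0 \<le> lp_norm p x"
  by (simp add: lp_norm_def)

lemma lp_norm_minus_commute: "lp_norm p (a - b) = lp_norm p (b - a)"
  by (simp add: lp_norm_def abs_minus_commute)

lemma lp_norm_powr:
  assumes "0 < p"
  shows "lp_norm p x powr p = (\<Sum>i\<in>UNIV. \<bar>x $ i\<bar> powr p)"
  using assms by (simp add: lp_norm_def powr_powr sum_nonneg)

lemma abs_component_le_lp_norm:
  assumes "0 < p"
  shows "\<bar>x $ i\<bar> \<le> lp_norm p x"
proof -
  have "\<bar>x $ i\<bar> powr p \<le> (\<Sum>i\<in>UNIV. \<bar>x $ i\<bar> powr p)"
    by (rule member_le_sum) auto
  then have "(\<bar>x $ i\<bar> powr p) powr (1 / p) \<le> lp_norm p x"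
    unfolding lp_norm_def by (rule powr_mono2[rotated 2]) (use assms in auto)
  then show ?thesis
    using assms by (simp add: powr_powr)
qed

lemma lp_norm_eq_0_iff:
  assumes "0 < p"
  shows "lp_norm p x = 0 \<longleftrightarrow> x = 0"
proof
  assume "lp_norm p x = 0"
  then have "\<bar>x $ i\<bar> \<le> 0" for i
    using abs_component_le_lp_norm[OF assms, of x i] by simp
  then show "x = 0"
    by (simp add: vec_eq_iff)
qed (use assms in \<open>simp add: lp_norm_def\<close>)

lemma norm_le_lp_norm:
  fixes x :: "real ^ 'q"
  assumes "0 < p"
  shows "norm x \<le> CARD('q) * lp_norm p x"
proof -
  have "norm x \<le> (\<Sum>i\<in>UNIV. \<bar>x $ i\<bar>)"
    by (rule norm_le_l1_cart)
  also have "\<dots> \<le> (\<Sum>i\<in>(UNIV :: 'q set). lp_norm p x)"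
    by (intro sum_mono abs_component_le_lp_norm assms)
  finally show ?thesis
    by simp
qed

lemma lp_norm_le_norm:
  fixes x :: "real ^ 'q"
  assumes "0 < p"
  shows "lp_norm p x \<le> CARD('q) powr (1 / p) * norm x"
proof -
  have "(\<Sum>i\<in>UNIV. \<bar>x $ i\<bar> powr p) \<le> (\<Sum>i\<in>(UNIV :: 'q set). norm x powr p)"
    using assms by (intro sum_mono powr_mono2) (auto simp: component_le_norm_cart)
  then have "lp_norm p x \<le> (CARD('q) * norm x powr p) powr (1 / p)"
    unfolding lp_norm_def using assms by (intro powr_mono2) (auto simp: sum_nonneg)
  also have "\<dots> = CARD('q) powr (1 / p) * norm x"
    using assms by (simp add: powr_mult powr_powr)
  finally show ?thesis .
qed

lemma continuous_on_lp_norm: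
  assumes "0 < p"
  shows "continuous_on S (lp_norm p)"
  unfolding lp_norm_def
  by (intro continuous_on_powr' continuous_intros)
     (use assms in \<open>auto simp: sum_nonneg\<close>)

lemma lp_grad_inner_self:
  assumes "1 < p" "z \<noteq> 0"
  shows "lp_grad p z \<bullet> z = lp_norm p z"
proof -
  let ?N = "lp_norm p z"
  have N: "0 < ?N"
    using assms lp_norm_eq_0_iff[of p z] lp_norm_nonneg[of p z] by simp
  have "\<bar>t\<bar> powr (p - 1) * sgn t * t = \<bar>t\<bar> powr p" for t :: real
    using assms by (cases "t = 0") (auto simp: powr_diff sgn_if)
  then have "lp_grad p z \<bullet> z = ?N powr p / ?N powr (p - 1)"
    using assms by (simp add: lp_grad_def inner_vec_def lp_norm_powr sum_divide_distrib)
  also have "\<dots> = ?N"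
    using N by (simp flip: powr_diff)
  finally show ?thesis .
qed

text \<open>This is the Hoelder inequality with the dual vector already normalised: the gradient has dual norm
  1. Young's inequality is applied to each coordinate after scaling both vectors to norm 1, and the
  resulting bounds add up to \<open>1 / p + 1 / p' = 1\<close>. Together with \<open>lp_grad_inner_self\<close> it
  exhibits the \<open>p\<close>-norm as a maximum of linear functionals, which yields the triangle inequality.\<close>

lemma lp_grad_inner_le:
  assumes "1 < p" "z \<noteq> 0"
  shows "lp_grad p z \<bullet> y \<le> lp_norm p y"
proof (cases "y = 0")
  case False
  define p' where "p' = p / (p - 1)"
  define N where "N = lp_norm p z"
  define M where "M = lp_norm p y"
  have N: "0 < N" and M: "0 < M"
    using assms False lp_norm_eq_0_iff[of p] lp_norm_nonneg[of p]
    by (auto simp: N_def M_def less_le)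
  have p': "1 < p'" "1 / p + 1 / p' = 1"
    using assms by (auto simp: p'_def field_simps)
  have young: "lp_grad p z $ i * (y $ i / M)
      \<le> (\<bar>y $ i\<bar> powr p / M powr p) / p + (\<bar>z $ i\<bar> powr p / N powr p) / p'" for i
  proof -
    have "lp_grad p z $ i * (y $ i / M) \<le> \<bar>lp_grad p z $ i * (y $ i / M)\<bar>"
      by (rule abs_ge_self)
    also have "\<bar>lp_grad p z $ i\<bar> \<le> (\<bar>z $ i\<bar> / N) powr (p - 1)"
      using N by (auto simp: lp_grad_def powr_divide abs_mult abs_sgn_eq N_def)
    then have "\<bar>lp_grad p z $ i * (y $ i / M)\<bar> \<le> (\<bar>y $ i\<bar> / M) * (\<bar>z $ i\<bar> / N) powr (p - 1)"
      using M by (simp add: abs_mult mult.commute mult_left_mono divide_right_mono)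
    also have "\<dots> \<le> (\<bar>y $ i\<bar> / M) powr p / p + ((\<bar>z $ i\<bar> / N) powr (p - 1)) powr p' / p'"
      using assms p' M by (intro Youngs_inequality) auto
    also have "((\<bar>z $ i\<bar> / N) powr (p - 1)) powr p' = (\<bar>z $ i\<bar> / N) powr p"
      using assms by (simp add: powr_powr p'_def)
    finally show ?thesis
      using N M by (simp add: powr_divide)
  qed
  have "(lp_grad p z \<bullet> y) / M = (\<Sum>i\<in>UNIV. lp_grad p z $ i * (y $ i / M))"
    by (simp add: inner_vec_def sum_divide_distrib)
  also have "\<dots> \<le> (\<Sum>i\<in>UNIV. (\<bar>y $ i\<bar> powr p / M powr p) / p + (\<bar>z $ i\<bar> powr p / N powr p) / p')"
    by (intro sum_mono young)
  also have "\<dots> = (M powr p / M powr p) / p + (N powr p / N powr p) / p'"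
    using assms by (simp add: sum.distrib lp_norm_powr M_def N_def flip: sum_divide_distrib)
  also have "\<dots> = 1"
    using N M p' by simp
  finally show ?thesis
    using M by (simp add: M_def divide_le_eq)
qed (simp add: lp_norm_nonneg)

lemma lp_norm_triangle:
  assumes "1 < p"
  shows "lp_norm p (x + y) \<le> lp_norm p x + lp_norm p y"
proof (cases "x + y = 0")
  case True
  then show ?thesis
    using assms lp_norm_eq_0_iff[of p "x + y"] lp_norm_nonneg[of p x] lp_norm_nonneg[of p y]
    by simp
next
  case False
  have "lp_norm p (x + y) = lp_grad p (x + y) \<bullet> x + lp_grad p (x + y) \<bullet> y"
    using lp_grad_inner_self[OF assms False] by (simp add: inner_add_right)
  also have "\<dots> \<le> lp_norm p x + lp_norm p y"
    by (intro add_mono lp_grad_inner_le assms False)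
  finally show ?thesis .
qed

lemma lp_norm_scaleR:
  assumes "0 < p"
  shows "lp_norm p (c *\<^sub>R x) = \<bar>c\<bar> * lp_norm p x"
  using assms
  by (simp add: lp_norm_def abs_mult powr_mult powr_powr sum_nonneg flip: sum_distrib_left)

text \<open>Here \<open>1 < p\<close> is essential: the factor \<open>\<bar>z $ i\<bar> powr (p - 1)\<close> absorbs the jump of the sign function at
  a vanishing coordinate.\<close>

lemma tendsto_lp_grad:
  fixes z :: "real ^ 'q"
  assumes "1 < p" "z \<noteq> 0" "(f \<longlongrightarrow> z) F"
  shows "((\<lambda>t. lp_grad p (f t)) \<longlongrightarrow> lp_grad p z) F"
  unfolding lp_grad_def
proof (intro tendsto_vec_lambda tendsto_divide)
  fix i
  have c: "((\<lambda>t. f t $ i) \<longlongrightarrow> z $ i) F"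
    using assms by (intro tendsto_intros)
  have a: "((\<lambda>t. \<bar>f t $ i\<bar> powr (p - 1)) \<longlongrightarrow> \<bar>z $ i\<bar> powr (p - 1)) F"
    by (intro tendsto_powr' tendsto_rabs c tendsto_const) (use assms in auto)
  show "((\<lambda>t. \<bar>f t $ i\<bar> powr (p - 1) * sgn (f t $ i)) \<longlongrightarrow> \<bar>z $ i\<bar> powr (p - 1) * sgn (z $ i)) F"
  proof (cases "z $ i = 0")
    case True
    have "((\<lambda>t. \<bar>f t $ i\<bar> powr (p - 1)) \<longlongrightarrow> 0) F"
      using a True by simp
    then have "((\<lambda>t. \<bar>f t $ i\<bar> powr (p - 1) * sgn (f t $ i)) \<longlongrightarrow> 0) F"
      by (rule Lim_null_comparison[rotated]) (auto simp: abs_mult abs_sgn_eq)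
    then show ?thesis
      using True by simp
  next
    case False
    then show ?thesis
      by (intro tendsto_mult a tendsto_sgn c)
  qed
next
  have "isCont (lp_norm p) z"
    using continuous_on_lp_norm[of p "UNIV :: (real ^ 'q) set"] assms by (simp add: continuous_on_eq_continuous_at)
  then have "((\<lambda>t. lp_norm p (f t)) \<longlongrightarrow> lp_norm p z) F"
    using assms(3) by (rule isCont_tendsto_compose)
  then show "((\<lambda>t. lp_norm p (f t) powr (p - 1)) \<longlongrightarrow> lp_norm p z powr (p - 1)) F"
    using assms by (intro tendsto_powr') (auto simp: lp_norm_eq_0_iff)
  show "lp_norm p z powr (p - 1) \<noteq> 0"
    using assms by (simp add: lp_norm_eq_0_iff)
qed

lemma lp_proj_minimizes:
  assumes "0 < p" "compact A" "A \<noteq> {}"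
  shows "lp_proj p A v \<in> A"
    and "a \<in> A \<Longrightarrow> lp_norm p (lp_proj p A v - v) \<le> lp_norm p (a - v)"
proof -
  have "continuous_on A (\<lambda>y. lp_norm p (y - v))"
    by (rule continuous_on_compose2[OF continuous_on_lp_norm[OF assms(1)]])
       (auto intro!: continuous_intros)
  then obtain y where "y \<in> A" "\<forall>a\<in>A. lp_norm p (y - v) \<le> lp_norm p (a - v)"
    using continuous_attains_inf assms by blast
  then have "is_arg_min (\<lambda>y. lp_norm p (y - v)) (\<lambda>y. y \<in> A) y"
    by (simp add: is_arg_min_linorder)
  then have "is_arg_min (\<lambda>y. lp_norm p (y - v)) (\<lambda>y. y \<in> A) (lp_proj p A v)"
    unfolding lp_proj_def arg_min_on_def arg_min_def by (rule someI)
  then show "lp_proj p A v \<in> A"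
    and "a \<in> A \<Longrightarrow> lp_norm p (lp_proj p A v - v) \<le> lp_norm p (a - v)"
    by (simp_all add: is_arg_min_linorder)
qed

text \<open>The first-order optimality condition for the projection. Let \<open>z\<close> point from \<open>v\<close> to its projection
  and \<open>d\<close> from the projection to \<open>a\<close>. As a functional, the gradient at
  \<open>z + t d\<close> equals the norm of \<open>z + t d\<close> at that point and is at most the norm of \<open>z\<close> at \<open>z\<close>. By
  minimality the former norm is at least the latter, so the functional is nonnegative on \<open>d\<close>.
  Continuity of the gradient passes this on to \<open>t = 0\<close>.\<close>

lemma lp_grad_supports:
  assumes "1 < p" "compact A" "convex A" "a \<in> A" "lp_proj p A v - v \<noteq> 0"
  shows "0 \<le> lp_grad p (lp_proj p A v - v) \<bullet> (a - lp_proj p A v)"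
proof -
  define y where "y = lp_proj p A v"
  define z where "z = y - v"
  define d where "d = a - y"
  have y: "y \<in> A" "\<And>b. b \<in> A \<Longrightarrow> lp_norm p z \<le> lp_norm p (b - v)"
    using lp_proj_minimizes[of p A] assms unfolding y_def z_def by auto
  have z: "z \<noteq> 0"
    using assms by (simp add: z_def y_def)
  have nonneg: "0 \<le> lp_grad p (z + t *\<^sub>R d) \<bullet> d" if t: "0 < t" "t \<le> 1" for t
  proof -
    have "(1 - t) *\<^sub>R y + t *\<^sub>R a \<in> A"
      using t y assms by (intro convexD) auto
    also have "(1 - t) *\<^sub>R y + t *\<^sub>R a = (z + t *\<^sub>R d) + v"
      by (simp add: z_def d_def algebra_simps)
    finally have le: "lp_norm p z \<le> lp_norm p (z + t *\<^sub>R d)"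
      using y(2) by fastforce
    then have nz: "z + t *\<^sub>R d \<noteq> 0"
      using z assms lp_norm_eq_0_iff[of p] lp_norm_nonneg[of p z]
      by (metis less_le_trans order_antisym zero_less_one less_trans)
    have "lp_norm p (z + t *\<^sub>R d)
        = lp_grad p (z + t *\<^sub>R d) \<bullet> z + t * (lp_grad p (z + t *\<^sub>R d) \<bullet> d)"
      using lp_grad_inner_self[OF assms(1) nz] by (simp add: inner_add_right)
    then have "0 \<le> t * (lp_grad p (z + t *\<^sub>R d) \<bullet> d)"
      using le lp_grad_inner_le[OF assms(1) nz, of z] by linarith
    then show ?thesis
      using t by (simp add: zero_le_mult_iff)
  qed
  have "((\<lambda>t. z + t *\<^sub>R d) \<longlongrightarrow> z + 0 *\<^sub>R d) (at_right 0)"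
    by (intro tendsto_intros)
  then have "((\<lambda>t. lp_grad p (z + t *\<^sub>R d) \<bullet> d) \<longlongrightarrow> lp_grad p z \<bullet> d) (at_right 0)"
    using assms z by (intro tendsto_inner tendsto_lp_grad tendsto_const) auto
  moreover have "\<forall>\<^sub>F t in at_right 0. 0 \<le> lp_grad p (z + t *\<^sub>R d) \<bullet> d"
    unfolding eventually_at_right_field using nonneg by (intro exI[of _ 1]) auto
  ultimately have "0 \<le> lp_grad p z \<bullet> d"
    by (rule tendsto_lowerbound) simp
  then show ?thesis
    by (simp add: z_def y_def d_def)
qed

section \<open>Packing in parallel bodies of a convex set\<close>

lemma one_plus_power_le:
  fixes t :: real
  assumes "0 \<le> t" "t \<le> 1"
  shows "(1 + t) ^ n \<le> 1 + (2 ^ n - 1) * t"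
proof (induction n)
  case (Suc n)
  have "(1 + t) ^ Suc n \<le> (1 + t) * (1 + (2 ^ n - 1) * t)"
    using Suc assms by simp
  also have "\<dots> = 1 + t + (2 ^ n - 1) * (t * (1 + t))"
    by (simp add: algebra_simps)
  also have "\<dots> \<le> 1 + t + (2 ^ n - 1) * (t * 2)"
    using assms by (intro add_left_mono mult_left_mono) auto
  finally show ?case
    by (simp add: algebra_simps)
qed simp

text \<open>If \<open>B\<close> is the closed unit ball and \<open>a0\<close> is the origin, then \<open>A \<subseteq> (1 + t) A\<close> by convexity, hence
  \<open>A + (1 + t) B \<subseteq> (1 + t) (A + B)\<close>. Comparing volumes, a shell of thickness \<open>t\<close> around
  \<open>A + B\<close> has volume \<open>O(t)\<close>.\<close>

lemma neighbourhood_subset_dilation: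
  fixes A :: "'a::euclidean_space set"
  assumes "closed A" "convex A" "a0 \<in> A" "0 \<le> t"
  shows "{x. infdist x A \<le> 1 + t}
    \<subseteq> (\<lambda>x. (1 + t) *\<^sub>R x + (- t *\<^sub>R a0)) ` {x. infdist x A \<le> 1}"
proof
  fix x assume x: "x \<in> {x. infdist x A \<le> 1 + t}"
  obtain a where a: "a \<in> A" "infdist x A = dist x a"
    using infdist_attains_inf assms by blast
  define y where "y = (1 / (1 + t)) *\<^sub>R (x + t *\<^sub>R a0)"
  define b where "b = (1 / (1 + t)) *\<^sub>R a + (t / (1 + t)) *\<^sub>R a0"
  have "b \<in> A"
    unfolding b_def using assms a by (intro convexD) (auto simp: field_simps)
  then have "infdist y A \<le> dist y b"
    by (rule infdist_le)
  also have "y - b = (1 / (1 + t)) *\<^sub>R (x - a)"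
    by (simp add: y_def b_def algebra_simps)
  then have "dist y b = dist x a / (1 + t)"
    using assms by (simp add: dist_norm)
  also have "\<dots> \<le> 1"
    using x a assms by simp
  finally have "y \<in> {x. infdist x A \<le> 1}"
    by simp
  moreover have "x = (1 + t) *\<^sub>R y + (- t *\<^sub>R a0)"
    using assms by (simp add: y_def)
  ultimately show "x \<in> (\<lambda>x. (1 + t) *\<^sub>R x + (- t *\<^sub>R a0)) ` {x. infdist x A \<le> 1}"
    by blast
qed

text \<open>A packing bound of the order of a hypersurface. The balls of radius \<open>\<delta>\<close> around the points are
  disjoint and lie in the shell between distance 1 and distance \<open>1 + 2 \<delta>\<close> from \<open>A\<close>. The volume of
  this shell is \<open>O(\<delta>)\<close> by the dilation bound, whereas each ball has volume of order \<open>\<delta>\<close> to the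
  dimension; so one power of \<open>\<delta>\<close> is gained over packing in full dimension.\<close>

lemma parallel_body_packing:
  fixes A :: "'a::euclidean_space set"
  assumes "compact A" "convex A" "A \<noteq> {}"
  obtains C :: real where "0 < C"
    "\<And>(\<delta> :: real) (I :: nat set) x. \<lbrakk>0 < \<delta>; \<delta> \<le> 1 / 2; finite I; \<And>i. i \<in> I \<Longrightarrow> infdist (x i) A = 1 + \<delta>;
       \<And>i j. \<lbrakk>i \<in> I; j \<in> I; i < j\<rbrakk> \<Longrightarrow> 2 * \<delta> \<le> dist (x i) (x j)\<rbrakk>
       \<Longrightarrow> card I * \<delta> ^ (DIM('a) - 1) \<le> C"
proof -
  define K where "K = {x. infdist x A \<le> 1}"
  define V where "V = measure lebesgue K"
  let ?d = "DIM('a)"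
  define \<omega> where "\<omega> = unit_ball_vol (real ?d)"
  have \<omega>: "0 < \<omega>"
    by (simp add: \<omega>_def)
  have "compact K"
    unfolding K_def using assms by (intro compact_infdist_le) auto
  then have K: "K \<in> lmeasurable"
    by (rule lmeasurable_compact)
  define C where "C = 2 * 2 ^ ?d * V / \<omega> + 1"
  have "0 \<le> V"
    by (simp add: V_def)
  then have "0 < C"
    using \<omega> unfolding C_def by (intro add_nonneg_pos) auto
  moreover have "card I * \<delta> ^ (?d - 1) \<le> C"
    if \<delta>: "0 < \<delta>" "\<delta> \<le> 1 / 2" and I: "finite I"
      and x: "\<And>i. i \<in> I \<Longrightarrow> infdist (x i) A = 1 + \<delta>"
      and sep: "\<And>i j. \<lbrakk>i \<in> I; j \<in> I; i < j\<rbrakk> \<Longrightarrow> 2 * \<delta> \<le> dist (x i) (x j)"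
    for \<delta> :: real and I :: "nat set" and x
  proof -
    let ?t = "2 * \<delta>"
    define K' where "K' = {x. infdist x A \<le> 1 + ?t}"
    have "compact K'"
      unfolding K'_def using assms \<delta> by (intro compact_infdist_le) auto
    then have K': "K' \<in> lmeasurable"
      by (rule lmeasurable_compact)
    obtain a0 where a0: "a0 \<in> A"
      using assms by blast
    let ?T = "\<lambda>x. (1 + ?t) *\<^sub>R x + (- ?t *\<^sub>R a0)"
    have TK: "?T ` K \<in> lmeasurable"
      by (intro lmeasurable_compact compact_continuous_image \<open>compact K\<close> continuous_intros)
    let ?B = "\<Union>i\<in>I. ball (x i) \<delta>"
    have "disjoint_family_on (\<lambda>i. ball (x i) \<delta>) I"
    proof (unfold disjoint_family_on_def, intro ballI impI)
      fix i j assume ij: "i \<in> I" "j \<in> I" "i \<noteq> j"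
      have "2 * \<delta> \<le> dist (x i) (x j)"
        using sep ij by (metis dist_commute linorder_neqE_nat)
      then show "ball (x i) \<delta> \<inter> ball (x j) \<delta> = {}"
        by (intro disjoint_ballI) simp
    qed
    moreover have "emeasure lborel (ball (x i) \<delta>) \<noteq> top" for i
      using emeasure_lborel_ball_finite[of "x i" \<delta>] by simp
    ultimately have "measure lebesgue ?B = (\<Sum>i\<in>I. measure lebesgue (ball (x i) \<delta>))"
      using I by (intro measure_finite_Union)
        (auto simp: image_subset_iff)
    also have "\<dots> = card I * (\<omega> * \<delta> ^ ?d)"
      using \<delta> by (simp add: content_ball \<omega>_def)
    finally have B: "measure lebesgue ?B = card I * (\<omega> * \<delta> ^ ?d)" .
    have Bm: "?B \<in> lmeasurable"
      using I by (intro fmeasurable.finite_UN) auto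
    have disj: "K \<inter> ?B = {}"
    proof (rule equals0I, clarify)
      fix y i assume "y \<in> K" "i \<in> I" "y \<in> ball (x i) \<delta>"
      then show False
        using infdist_triangle[of "x i" A y] x[of i] by (simp add: K_def)
    qed
    have sub: "K \<union> ?B \<subseteq> K'"
    proof (rule Un_least)
      show "K \<subseteq> K'"
        using \<delta> by (auto simp: K_def K'_def)
      show "?B \<subseteq> K'"
      proof clarify
        fix y i assume "i \<in> I" "y \<in> ball (x i) \<delta>"
        then show "y \<in> K'"
          using infdist_triangle[of y A "x i"] x[of i] by (simp add: K'_def dist_commute)
      qed
    qed
    have "V + card I * (\<omega> * \<delta> ^ ?d) = measure lebesgue (K \<union> ?B)"
      using measure_Un3[OF K Bm] disj B by (simp add: V_def)
    also have "\<dots> \<le> measure lebesgue (?T ` K)"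
    proof (rule measure_mono_fmeasurable)
      show "K \<union> ?B \<subseteq> ?T ` K"
        using sub neighbourhood_subset_dilation[of A a0 ?t] a0 assms \<delta>
        unfolding K_def K'_def by (auto simp: compact_imp_closed)
    qed (use K Bm TK in auto)
    also have "\<dots> = (1 + ?t) ^ ?d * V"
      using \<delta> unfolding V_def measure_lebesgue_affine by simp
    also have "\<dots> \<le> (1 + (2 ^ ?d - 1) * ?t) * V"
      using \<delta> \<open>0 \<le> V\<close> by (intro mult_right_mono one_plus_power_le) auto
    also have "\<dots> \<le> (1 + 2 ^ ?d * ?t) * V"
      using \<delta> \<open>0 \<le> V\<close> by (intro mult_right_mono add_left_mono) auto
    finally have le: "card I * (\<omega> * \<delta> ^ ?d) \<le> 2 ^ ?d * ?t * V"
      by (simp add: algebra_simps)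
    have "\<delta> ^ ?d = \<delta> * \<delta> ^ (?d - 1)"
      by (metis DIM_positive power_eq_if not_gr_zero)
    then have "\<delta> * (\<omega> * (card I * \<delta> ^ (?d - 1))) \<le> \<delta> * (2 * 2 ^ ?d * V)"
      using le by (simp add: algebra_simps)
    then have "\<omega> * (card I * \<delta> ^ (?d - 1)) \<le> 2 * 2 ^ ?d * V"
      using \<delta> by simp
    then have "card I * \<delta> ^ (?d - 1) \<le> 2 * 2 ^ ?d * V / \<omega>"
      using \<omega> by (simp add: field_simps)
    then show ?thesis
      by (simp add: C_def)
  qed
  ultimately show ?thesis
    using that by blast
qed

section \<open>Rate of convergence of cutting schemes\<close>

lemma infdist_outward_normal:
  fixes A :: "'a::euclidean_space set"
  assumes "y \<in> A" "norm n = 1" "\<And>a. a \<in> A \<Longrightarrow> 0 \<le> n \<bullet> (a - y)" "0 \<le> s"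
  shows "infdist (y - s *\<^sub>R n) A = s"
proof (rule antisym)
  show "infdist (y - s *\<^sub>R n) A \<le> s"
    using infdist_le[OF assms(1), of "y - s *\<^sub>R n"] assms by (simp add: dist_norm)
  have "s \<le> dist (y - s *\<^sub>R n) a" if "a \<in> A" for a
  proof -
    have "s \<le> n \<bullet> (a - y) + s * (n \<bullet> n)"
      using assms that by (simp add: dot_square_norm)
    also have "\<dots> = n \<bullet> (a - (y - s *\<^sub>R n))"
      by (simp add: algebra_simps)
    also have "\<dots> \<le> norm (a - (y - s *\<^sub>R n))"
      using norm_cauchy_schwarz[of n "a - (y - s *\<^sub>R n)"] assms by simp
    finally show ?thesis
      by (simp add: dist_norm norm_minus_commute)
  qed
  then show "s \<le> infdist (y - s *\<^sub>R n) A"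
    using assms unfolding infdist_def by (auto intro!: cINF_greatest)
qed

text \<open>The geometric core. The vectors \<open>n\<close>, \<open>n'\<close> are inner unit normals of \<open>A\<close> at \<open>y\<close>, \<open>y'\<close>, and the
  vertex \<open>y' - z\<close>, at depth at least \<open>c h\<close> behind the second supporting hyperplane, satisfies the
  first cut. If the two normals are close, then the vertex is also nearly that deep in direction \<open>n\<close>,
  and surviving the first cut forces \<open>n \<bullet> (y' - y)\<close> to be of order \<open>h\<close>. Moving outward along the
  normals turns this first-order gap into a squared distance, because
  \<open>|(y - s n) - (y' - s n')|\<^sup>2 = |y - y'|\<^sup>2 + s\<^sup>2 |n - n'|\<^sup>2 + 2 s (n \<bullet> (y' - y) + n' \<bullet> (y - y'))\<close>
  with every term nonnegative. So the separation is of order \<open>sqrt h\<close>, which is the source of the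
  exponent 2.\<close>

lemma deep_cuts_separated:
  fixes A :: "'a::euclidean_space set"
  assumes "y \<in> A" "y' \<in> A" and norms: "norm n = 1" "norm n' = 1"
    and supp: "\<And>a. a \<in> A \<Longrightarrow> 0 \<le> n \<bullet> (a - y)" "\<And>a. a \<in> A \<Longrightarrow> 0 \<le> n' \<bullet> (a - y')"
    and cut: "n \<bullet> z \<le> n \<bullet> (y' - y)"
    and z: "c * h \<le> n' \<bullet> z" "norm z \<le> L * h"
    and pos: "0 < c" "0 < L" "0 \<le> h" "1 \<le> s"
  shows "min (sqrt (c * h)) (c / (2 * L)) \<le> dist (y - s *\<^sub>R n) (y' - s *\<^sub>R n')"
proof -
  let ?D = "dist (y - s *\<^sub>R n) (y' - s *\<^sub>R n')"
  have D: "?D\<^sup>2 = (norm (y - y'))\<^sup>2 + s\<^sup>2 * (norm (n - n'))\<^sup>2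
      + 2 * s * (n \<bullet> (y' - y) + n' \<bullet> (y - y'))"
  proof -
    have "y - s *\<^sub>R n - (y' - s *\<^sub>R n') = (y - y') - s *\<^sub>R (n - n')"
      by (simp add: algebra_simps)
    then have "?D\<^sup>2 = ((y - y') - s *\<^sub>R (n - n')) \<bullet> ((y - y') - s *\<^sub>R (n - n'))"
      by (simp only: dist_norm power2_norm_eq_inner)
    also have "\<dots> = (y - y') \<bullet> (y - y') + s\<^sup>2 * ((n - n') \<bullet> (n - n'))
        - 2 * s * ((n - n') \<bullet> (y - y'))"
      by (simp add: inner_diff_left[of "y - y'"] inner_diff_right[of _ "y - y'"] inner_commute
          power2_eq_square)
    also have "(n - n') \<bullet> (y - y') = - (n \<bullet> (y' - y) + n' \<bullet> (y - y'))"
      by (simp add: inner_diff_left inner_diff_right)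
    finally show ?thesis
      by (simp add: power2_norm_eq_inner right_diff_distrib distrib_left)
  qed
  have ny: "0 \<le> n \<bullet> (y' - y)" "0 \<le> n' \<bullet> (y - y')"
    using supp assms(1,2) by auto
  show ?thesis
  proof (cases "norm (n - n') \<le> c / (2 * L)")
    case True
    have "(n' - n) \<bullet> z \<le> norm (n' - n) * norm z"
      by (rule norm_cauchy_schwarz)
    also have "\<dots> \<le> c / (2 * L) * (L * h)"
      using True z pos by (intro mult_mono) (auto simp: norm_minus_commute)
    finally have "c * h / 2 \<le> n \<bullet> z"
      using z pos by (simp add: inner_diff_left)
    then have "c * h \<le> 2 * (n \<bullet> (y' - y) + n' \<bullet> (y - y'))"
      using cut ny by simp
    also have "\<dots> \<le> 2 * s * (n \<bullet> (y' - y) + n' \<bullet> (y - y'))"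
      using ny pos by (intro mult_right_mono) auto
    also have "\<dots> \<le> ?D\<^sup>2"
      using D by simp
    finally have "sqrt (c * h) \<le> ?D"
      by (simp add: real_le_lsqrt)
    then show ?thesis
      by simp
  next
    case False
    have "(s * norm (n - n'))\<^sup>2 \<le> ?D\<^sup>2"
      using D ny pos by (simp add: power_mult_distrib)
    then have "s * norm (n - n') \<le> ?D"
      by (rule power2_le_imp_le) simp
    moreover have "norm (n - n') \<le> s * norm (n - n')"
      using pos by (simp add: mult_le_cancel_right1)
    ultimately show ?thesis
      using False by simp
  qed
qed

text \<open>Here \<open>y j\<close> is the boundary point at which step \<open>j\<close> cuts, \<open>n j\<close> the inner normal of the cut, and
  \<open>y j - z j\<close> the point cut off, whose depth and Euclidean distance to \<open>y j\<close> are comparable to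
  \<open>h j\<close>. The depths decrease, so after \<open>k\<close> steps all outward points are separated at the scale
  \<open>sqrt (h k)\<close>, and for large \<open>k\<close> the packing bound reads \<open>k * sqrt (h k) ^ (d - 1) \<le> C\<close> up to
  constants, with \<open>d\<close> the dimension. The constant is chosen
  before the scheme and depends only on the body and on the two comparison constants.\<close>

proposition cutting_scheme_rate:
  fixes A :: "'a::euclidean_space set"
  assumes "compact A" "convex A" "A \<noteq> {}" and dim: "2 \<le> DIM('a)" and pos: "0 < c" "0 < L"
  obtains \<Lambda> :: real where "0 < \<Lambda>"
    "\<And>y n z h. \<lbrakk>\<And>i. y i \<in> A; \<And>i. norm (n i) = 1; \<And>i a. a \<in> A \<Longrightarrow> 0 \<le> n i \<bullet> (a - y i);
        \<And>i j. i < j \<Longrightarrow> n i \<bullet> z j \<le> n i \<bullet> (y j - y i);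
        \<And>i. c * h i \<le> n i \<bullet> z i; \<And>i. norm (z i) \<le> L * h i;
        \<And>i. 0 < h i; decseq h\<rbrakk>
      \<Longrightarrow> \<forall>\<^sub>F k :: nat in sequentially. h k \<le> \<Lambda> * real k powr (2 / (1 - real DIM('a)))"
proof -
  define m where "m = DIM('a) - 1"
  have m: "0 < m" "real m = real DIM('a) - 1"
    using dim by (auto simp: m_def)
  obtain C :: real where C: "0 < C"
    and packing: "\<And>(\<delta> :: real) (I :: nat set) x. \<lbrakk>0 < \<delta>; \<delta> \<le> 1 / 2; finite I;
       \<And>i. i \<in> I \<Longrightarrow> infdist (x i) A = 1 + \<delta>;
       \<And>i j. \<lbrakk>i \<in> I; j \<in> I; i < j\<rbrakk> \<Longrightarrow> 2 * \<delta> \<le> dist (x i) (x j)\<rbrakk>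
       \<Longrightarrow> card I * \<delta> ^ m \<le> C"
    using parallel_body_packing[OF assms(1-3), folded m_def] by metis
  \<comment> \<open>The separation of the outward points saturates at \<open>c / (2 * L)\<close>, and balls have half that
    radius. For large \<open>k\<close> the packing bound pushes the radius below this cap \<open>r\<close>, so that the radius
    is determined by \<open>h k\<close>.\<close>
  define r where "r = min (c / (4 * L)) (1 / 2)"
  have r: "0 < r"
    using pos by (simp add: r_def)
  define \<Lambda> where "\<Lambda> = 4 / c * C powr (2 / m)"
  have "0 < \<Lambda>"
    using pos C by (simp add: \<Lambda>_def)
  moreover have "\<forall>\<^sub>F k in sequentially. h k \<le> \<Lambda> * real k powr (2 / (1 - real DIM('a)))"
    if y: "\<And>i. y i \<in> A" and n: "\<And>i. norm (n i) = 1"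
      and supp: "\<And>i a. a \<in> A \<Longrightarrow> 0 \<le> n i \<bullet> (a - y i)"
      and cut: "\<And>i j. i < j \<Longrightarrow> n i \<bullet> z j \<le> n i \<bullet> (y j - y i)"
      and z: "\<And>i. c * h i \<le> n i \<bullet> z i" "\<And>i. norm (z i) \<le> L * h i"
      and h: "\<And>i. 0 < h i" "decseq h"
    for y n z h
  proof -
    have bound: "h k \<le> \<Lambda> * real k powr (2 / (1 - real DIM('a)))"
      if k: "C / r ^ m < real k" for k :: nat
    proof -
      define \<delta> where "\<delta> = min (sqrt (c * h k) / 2) r"
      have \<delta>: "0 < \<delta>" "\<delta> \<le> 1 / 2"
        using pos h r by (auto simp: \<delta>_def r_def)
      have k0: "0 < real k"
        using k C r by (smt (verit) divide_nonneg_pos zero_less_power)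
      \<comment> \<open>The outward distance \<open>1 + \<delta>\<close> places the balls of radius \<open>\<delta>\<close> just outside \<open>A + B\<close>.\<close>
      have "card {1..k} * \<delta> ^ m \<le> C"
      proof (rule packing[where x = "\<lambda>i. y i - (1 + \<delta>) *\<^sub>R n i"])
        fix i j assume ij: "i \<in> {1..k}" "j \<in> {1..k}" "i < j"
        have "h k \<le> h j"
          using ij h by (auto simp: decseq_def)
        then have "sqrt (c * h k) \<le> sqrt (c * h j)"
          using pos by (intro real_sqrt_le_mono mult_left_mono) auto
        moreover have "\<delta> \<le> sqrt (c * h k) / 2" "\<delta> \<le> c / (4 * L)"
          by (simp_all add: \<delta>_def r_def)
        ultimately have "2 * \<delta> \<le> min (sqrt (c * h j)) (c / (2 * L))"
          by (intro min.boundedI) linarith+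
        also have "\<dots> \<le> dist (y i - (1 + \<delta>) *\<^sub>R n i) (y j - (1 + \<delta>) *\<^sub>R n j)"
          using \<delta> pos h(1)[of j]
          by (intro deep_cuts_separated[where A = A and z = "z j"] y n supp cut ij z) auto
        finally show "2 * \<delta> \<le> dist (y i - (1 + \<delta>) *\<^sub>R n i) (y j - (1 + \<delta>) *\<^sub>R n j)" .
      qed (use \<delta> in \<open>auto intro!: infdist_outward_normal y n supp\<close>)
      then have \<delta>C: "\<delta> ^ m \<le> C / real k"
        using k0 by (simp add: field_simps)
      also have "\<dots> < r ^ m"
        using k k0 r by (simp add: field_simps)
      finally have "\<delta> < r"
        using r by (simp add: power_less_imp_less_base)
      then have \<delta>h: "\<delta>\<^sup>2 = c * h k / 4"
        using pos h(1)[of k] by (auto simp: \<delta>_def min_def power_divide split: if_splits)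
      have "\<delta>\<^sup>2 = \<delta> powr (real m * (2 / real m))"
        using \<delta> m(1) by simp
      also have "\<dots> = (\<delta> powr m) powr (2 / m)"
        by (rule powr_powr[symmetric])
      also have "\<dots> \<le> (C / real k) powr (2 / m)"
        using \<delta>C \<delta> by (intro powr_mono2) (auto simp: powr_realpow)
      also have "\<dots> = C powr (2 / m) * real k powr (- (2 / m))"
        using C by (simp add: powr_divide powr_minus_divide)
      also have "- (2 / real m) = 2 / (1 - real DIM('a))"
        unfolding m(2) by (simp only: minus_divide_right minus_diff_eq)
      finally show ?thesis
        using \<delta>h pos by (simp add: \<Lambda>_def field_simps)
    qed
    have "\<forall>\<^sub>F k in sequentially. C / r ^ m < real k"
      using filterlim_real_sequentially by (simp add: filterlim_at_top_dense)
    then show ?thesis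
      by (rule eventually_mono) (rule bound)
  qed
  ultimately show ?thesis
    using that by blast
qed

section \<open>Distance of a polytope to a convex subset\<close>

text \<open>The points within distance \<open>h\<close> of a convex set form a convex set, so the distance to \<open>A\<close> over a
  polytope is largest at a vertex. For this reason the algorithm, which looks at vertices only,
  controls the Hausdorff distance.\<close>

lemma lp_distance_le_on_polytope:
  fixes A P :: "(real ^ 'q) set"
  assumes "1 < p" "convex A" "polytope P" "x \<in> P"
    and vertices: "\<And>u. u extreme_point_of P \<Longrightarrow> \<exists>a\<in>A. lp_norm p (a - u) \<le> h"
  shows "\<exists>a\<in>A. lp_norm p (a - x) \<le> h"
proof -
  have "convex {x. \<exists>a\<in>A. lp_norm p (a - x) \<le> h}"
  proof (rule convexI, clarify)
    fix x y a b and s t :: real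
    assume st: "0 \<le> s" "0 \<le> t" "s + t = 1"
      and a: "a \<in> A" "lp_norm p (a - x) \<le> h" and b: "b \<in> A" "lp_norm p (b - y) \<le> h"
    have "lp_norm p ((s *\<^sub>R a + t *\<^sub>R b) - (s *\<^sub>R x + t *\<^sub>R y))
        = lp_norm p (s *\<^sub>R (a - x) + t *\<^sub>R (b - y))"
      by (simp add: algebra_simps)
    also have "\<dots> \<le> s * lp_norm p (a - x) + t * lp_norm p (b - y)"
      using lp_norm_triangle[OF assms(1), of "s *\<^sub>R (a - x)" "t *\<^sub>R (b - y)"] assms st
      by (simp add: lp_norm_scaleR)
    also have "\<dots> \<le> s * h + t * h"
      using a b st by (intro add_mono mult_left_mono) auto
    also have "\<dots> = h"
      using st by (simp flip: distrib_right)
    finally show "\<exists>c\<in>A. lp_norm p (c - (s *\<^sub>R x + t *\<^sub>R y)) \<le> h"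
      using convexD[OF assms(2) a(1) b(1) st] by blast
  qed
  then have "convex hull {u. u extreme_point_of P} \<subseteq> {x. \<exists>a\<in>A. lp_norm p (a - x) \<le> h}"
    using vertices by (intro hull_minimal) auto
  moreover have "x \<in> convex hull {u. u extreme_point_of P}"
    using Krein_Milman_Minkowski[of P] assms polytope_imp_compact polytope_imp_convex by blast
  ultimately show ?thesis
    by blast
qed

lemma INF_lp_norm_le:
  assumes "a \<in> A" "lp_norm p (f a) \<le> h"
  shows "(INF a\<in>A. lp_norm p (f a)) \<le> h"
proof (rule cINF_lower2[where f = "\<lambda>a. lp_norm p (f a)", OF _ assms])
  show "bdd_below ((\<lambda>a. lp_norm p (f a)) ` A)"
    by (rule bdd_belowI2[of _ 0]) (rule lp_norm_nonneg)
qed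

lemma lp_hausdorff_bounds:
  fixes A P :: "(real ^ 'q) set"
  assumes "A \<noteq> {}" "A \<subseteq> P" "0 < p" "\<And>x. x \<in> P \<Longrightarrow> \<exists>a\<in>A. lp_norm p (a - x) \<le> h"
  shows "0 \<le> lp_hausdorff p P A" "lp_hausdorff p P A \<le> h"
proof -
  obtain a where a: "a \<in> A" "a \<in> P"
    using assms by blast
  obtain b where "lp_norm p (b - a) \<le> h"
    using assms(4) a by blast
  then have h: "0 \<le> h"
    using lp_norm_nonneg order_trans by blast
  have near: "(INF b\<in>A. lp_norm p (x - b)) \<le> h" if "x \<in> P" for x
  proof -
    obtain b where b: "b \<in> A" "lp_norm p (b - x) \<le> h"
      using assms(4)[OF \<open>x \<in> P\<close>] by blast
    show ?thesis
      by (rule INF_lp_norm_le[OF b(1)]) (use b in \<open>simp add: lp_norm_minus_commute[of p x]\<close>)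
  qed
  have "(SUP x\<in>P. INF b\<in>A. lp_norm p (x - b)) \<le> h"
    using a by (intro cSUP_least near) auto
  moreover have "(SUP b\<in>A. INF x\<in>P. lp_norm p (x - b)) \<le> 0"
  proof (rule cSUP_least[OF assms(1)])
    fix b assume b: "b \<in> A"
    show "(INF x\<in>P. lp_norm p (x - b)) \<le> 0"
      by (rule INF_lp_norm_le[of b]) (use b assms lp_norm_eq_0_iff[of p "b - b"] in auto)
  qed
  ultimately show "lp_hausdorff p P A \<le> h"
    using h by (simp add: lp_hausdorff_def)
  have "0 \<le> (INF b\<in>A. lp_norm p (a - b))"
    by (rule cINF_greatest[OF assms(1)]) (rule lp_norm_nonneg)
  also have "\<dots> \<le> (SUP x\<in>P. INF b\<in>A. lp_norm p (x - b))"
    by (rule cSUP_upper[OF a(2)]) (rule bdd_aboveI2[OF near])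
  finally show "0 \<le> lp_hausdorff p P A"
    by (simp add: lp_hausdorff_def)
qed

section \<open>Runs of the norm-minimization algorithm\<close>

definition support_point :: "real \<Rightarrow> (real ^ 'q) set \<Rightarrow> (nat \<Rightarrow> real ^ 'q) \<Rightarrow> nat \<Rightarrow> real ^ 'q" where
  "support_point p A v k = lp_proj p A (v k)"

definition residual :: "real \<Rightarrow> (real ^ 'q) set \<Rightarrow> (nat \<Rightarrow> real ^ 'q) \<Rightarrow> nat \<Rightarrow> real ^ 'q" where
  "residual p A v k = lp_proj p A (v k) - v k"

context
  fixes p :: real and A :: "(real ^ 'q) set" and P v
  assumes p: "1 < p" and A: "compact A" "convex A" "A \<noteq> {}"
    and run: "norm_min_run p A P v"
begin

lemma run_step:
  "P (Suc k) = P k \<inter> {x. lp_grad p (residual p A v k) \<bullet> support_point p A v k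
      \<le> lp_grad p (residual p A v k) \<bullet> x}"
  using run by (simp add: norm_min_run_def Let_def residual_def support_point_def)

lemma run_vertex: "v k extreme_point_of P k"
  using run by (simp add: norm_min_run_def)

lemma run_residual_nonzero: "residual p A v k \<noteq> 0"
  using run by (simp add: norm_min_run_def residual_def)

lemma run_supports:
  "a \<in> A \<Longrightarrow> 0 \<le> lp_grad p (residual p A v k) \<bullet> (a - support_point p A v k)"
  using lp_grad_supports[OF p A(1,2), of a "v k"] run_residual_nonzero[of k]
  by (simp add: residual_def support_point_def)

lemma run_outer: "A \<subseteq> P k"
proof (induction k)
  case 0
  then show ?case
    using run by (simp add: norm_min_run_def initial_outer_approx_def)
next
  case (Suc k)
  then show ?case
    using run_supports[of _ k] by (auto simp: run_step inner_diff_right)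
qed

lemma run_polytope: "polytope (P k)"
proof (induction k)
  case 0
  then show ?case
    using run by (simp add: norm_min_run_def initial_outer_approx_def)
next
  case (Suc k)
  then show ?case
    unfolding run_step
    by (intro polytope_Int_polyhedron) (auto intro: polyhedron_halfspace_ge)
qed

lemma run_antimono: "i \<le> j \<Longrightarrow> P j \<subseteq> P i"
  by (rule lift_Suc_antimono_le[of P]) (auto simp: run_step)

lemma run_distance:
  assumes "x \<in> P k"
  shows "\<exists>a\<in>A. lp_norm p (a - x) \<le> lp_norm p (residual p A v k)"
proof (rule lp_distance_le_on_polytope[OF p A(2) run_polytope assms])
  fix u assume "u extreme_point_of P k"
  then have "lp_norm p (lp_proj p A u - u) \<le> lp_norm p (residual p A v k)"
    using run by (simp add: norm_min_run_def residual_def)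
  then show "\<exists>a\<in>A. lp_norm p (a - u) \<le> lp_norm p (residual p A v k)"
    using lp_proj_minimizes(1)[of p A u] p A by auto
qed

text \<open>The next vertex belongs to the previous polytope, all of which is within the previous largest
  distance.\<close>

lemma run_residual_decseq: "decseq (\<lambda>k. lp_norm p (residual p A v k))"
proof (rule decseq_SucI)
  fix k
  have "v (Suc k) \<in> P k"
    using run_vertex[of "Suc k"] run_antimono[of k "Suc k"] by (auto simp: extreme_point_of_def)
  then obtain a where a: "a \<in> A" "lp_norm p (a - v (Suc k)) \<le> lp_norm p (residual p A v k)"
    using run_distance by blast
  then show "lp_norm p (residual p A v (Suc k)) \<le> lp_norm p (residual p A v k)"
    using lp_proj_minimizes(2)[of p A a "v (Suc k)"] p A by (simp add: residual_def)
qed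

text \<open>Rewritten in terms of the projections, this says that the vertex selected in step \<open>j\<close> has survived
  the cut made in step \<open>i\<close>.\<close>

lemma run_cut:
  assumes "i < j"
  shows "lp_grad p (residual p A v i) \<bullet> residual p A v j
    \<le> lp_grad p (residual p A v i) \<bullet> (support_point p A v j - support_point p A v i)"
proof -
  have "v j \<in> P (Suc i)"
    using run_vertex[of j] run_antimono[of "Suc i" j] assms by (auto simp: extreme_point_of_def)
  then show ?thesis
    by (simp add: run_step residual_def support_point_def inner_diff_right)
qed

end

section \<open>Convergence rate of the algorithm\<close>

text \<open>These bounds make the depth of a vertex measured by the Euclidean unit normal comparable to its
  distance in the \<open>p\<close>-norm.\<close>

lemma lp_grad_norm_bounds:
  fixes z :: "real ^ 'q"
  assumes "1 < p" "z \<noteq> 0"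
  shows "0 < norm (lp_grad p z)" "norm (lp_grad p z) \<le> CARD('q) powr (1 / p)"
proof -
  let ?g = "lp_grad p z"
  have "?g \<bullet> z \<noteq> 0"
    using assms by (simp add: lp_grad_inner_self lp_norm_eq_0_iff)
  then show pos: "0 < norm ?g"
    by auto
  have "norm ?g * norm ?g = ?g \<bullet> ?g"
    by (simp add: dot_square_norm power2_eq_square)
  also have "\<dots> \<le> lp_norm p ?g"
    by (rule lp_grad_inner_le[OF assms])
  also have "\<dots> \<le> CARD('q) powr (1 / p) * norm ?g"
    using assms by (intro lp_norm_le_norm) auto
  finally show "norm ?g \<le> CARD('q) powr (1 / p)"
    using pos by simp
qed

proposition norm_min_run_rate:
  fixes A :: "(real ^ 'q) set"
  assumes "2 \<le> CARD('q)" "1 < p" "compact A" "convex A" "A \<noteq> {}"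
  obtains \<Lambda> :: real where "0 < \<Lambda>"
    "\<And>P v. norm_min_run p A P v \<Longrightarrow> \<forall>\<^sub>F k in sequentially.
       0 \<le> lp_hausdorff p (P k) A \<and>
       lp_hausdorff p (P k) A \<le> \<Lambda> * real k powr (2 / (1 - real CARD('q)))"
proof -
  define c where "c = 1 / CARD('q) powr (1 / p)"
  have c: "0 < c" "0 < real CARD('q)" and dim: "2 \<le> DIM(real ^ 'q)"
    using assms(1) by (simp_all add: c_def)
  obtain \<Lambda> :: real where \<Lambda>: "0 < \<Lambda>"
    and rate: "\<And>(y :: nat \<Rightarrow> real ^ 'q) n z h. \<lbrakk>\<And>i. y i \<in> A; \<And>i. norm (n i) = 1;
        \<And>i a. a \<in> A \<Longrightarrow> 0 \<le> n i \<bullet> (a - y i);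
        \<And>i j. i < j \<Longrightarrow> n i \<bullet> z j \<le> n i \<bullet> (y j - y i);
        \<And>i. c * h i \<le> n i \<bullet> z i; \<And>i. norm (z i) \<le> real CARD('q) * h i;
        \<And>i. 0 < h i; decseq h\<rbrakk>
      \<Longrightarrow> \<forall>\<^sub>F k :: nat in sequentially. h k \<le> \<Lambda> * real k powr (2 / (1 - real DIM(real ^ 'q)))"
    by (rule cutting_scheme_rate[OF assms(3-5) dim c]) blast
  have "\<forall>\<^sub>F k in sequentially. 0 \<le> lp_hausdorff p (P k) A \<and>
       lp_hausdorff p (P k) A \<le> \<Lambda> * real k powr (2 / (1 - real CARD('q)))"
    if run: "norm_min_run p A P v" for P v
  proof -
    let ?z = "residual p A v" and ?y = "support_point p A v"
    let ?g = "\<lambda>k. lp_grad p (?z k)"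
    define n where "n k = ?g k /\<^sub>R norm (?g k)" for k
    note run_facts = assms(2-5) run
    have z0: "?z k \<noteq> 0" for k
      by (rule run_residual_nonzero[OF run_facts])
    note g = lp_grad_norm_bounds[OF assms(2) z0]
    have n_inner: "n k \<bullet> x = (?g k \<bullet> x) / norm (?g k)" for k x
      by (simp add: n_def divide_inverse_commute)
    have "\<forall>\<^sub>F k in sequentially.
        lp_norm p (?z k) \<le> \<Lambda> * real k powr (2 / (1 - real DIM(real ^ 'q)))"
    proof (rule rate[of ?y n ?z])
      show "?y i \<in> A" for i
        using lp_proj_minimizes(1)[of p A "v i"] assms by (simp add: support_point_def)
      show "norm (n i) = 1" for i
        using g(1)[of i] by (simp add: n_def)
      show "0 \<le> n i \<bullet> (a - ?y i)" if "a \<in> A" for i a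
        using run_supports[OF run_facts that, of i] by (simp add: n_inner)
      show "n i \<bullet> ?z j \<le> n i \<bullet> (?y j - ?y i)" if "i < j" for i j
        using run_cut[OF run_facts that] unfolding n_inner by (intro divide_right_mono) auto
      show "c * lp_norm p (?z i) \<le> n i \<bullet> ?z i" for i
      proof -
        have "lp_norm p (?z i) / CARD('q) powr (1 / p) \<le> lp_norm p (?z i) / norm (?g i)"
          using g[of i] by (intro divide_left_mono lp_norm_nonneg) auto
        then show ?thesis
          using assms by (simp add: c_def n_inner lp_grad_inner_self z0)
      qed
      show "norm (?z i) \<le> CARD('q) * lp_norm p (?z i)" for i
        using assms by (intro norm_le_lp_norm) auto
      show "0 < lp_norm p (?z i)" for i
        using z0[of i] assms lp_norm_nonneg[of p "?z i"] lp_norm_eq_0_iff[of p "?z i"] by simp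
      show "decseq (\<lambda>k. lp_norm p (?z k))"
        by (rule run_residual_decseq[OF run_facts])
    qed
    then show ?thesis
    proof (rule eventually_mono)
      fix k assume k: "lp_norm p (?z k) \<le> \<Lambda> * real k powr (2 / (1 - real DIM(real ^ 'q)))"
      have "0 < p"
        using assms by simp
      note bounds = lp_hausdorff_bounds[OF assms(5) run_outer[OF run_facts, of k] this
          run_distance[OF run_facts, of _ k]]
      show "0 \<le> lp_hausdorff p (P k) A \<and>
          lp_hausdorff p (P k) A \<le> \<Lambda> * real k powr (2 / (1 - real CARD('q)))"
        using bounds k by simp
    qed
  qed
  with \<Lambda> that show ?thesis
    by blast
qed

theorem theorem11:
  fixes p R :: real and A :: "(real ^ 'q) set"
  assumes "2 \<le> CARD('q)" and "1 < p" and "0 < R"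
    and "compact A" and "convex A" and "interior A \<noteq> {}"
    and "\<exists>c. A \<subseteq> {y. lp_norm p (y - c) \<le> R}"
  shows "\<exists>\<Lambda>>0. \<forall>n C X \<Gamma> P v.
           1 \<le> n \<and> ordering_cone C \<and> feasible_set n X \<and>
           continuous_map (subtopology (Euclidean_space n) X) euclidean \<Gamma> \<and>
           cone_convex_on C X \<Gamma> \<and> slice_of C (\<Gamma> ` X + C) A \<and>
           norm_min_run p A P v \<longrightarrow>
             (\<lambda>k. lp_hausdorff p (P k) A) \<in> O(\<lambda>k. real k powr (2 / (1 - real CARD('q)))) \<and>
             (\<forall>\<epsilon>>0. \<exists>K. \<forall>k\<ge>K.
                lp_hausdorff p (P k) A \<le> (1 + \<epsilon>) * \<Lambda> * real k powr (2 / (1 - real CARD('q))))"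
proof -
  let ?r = "\<lambda>k. real k powr (2 / (1 - real CARD('q)))"
  have "A \<noteq> {}"
    using assms(6) interior_subset by fastforce
  then obtain \<Lambda> :: real where \<Lambda>: "0 < \<Lambda>"
    and rate: "\<And>P v. norm_min_run p A P v \<Longrightarrow> \<forall>\<^sub>F k in sequentially.
       0 \<le> lp_hausdorff p (P k) A \<and> lp_hausdorff p (P k) A \<le> \<Lambda> * ?r k"
    by (rule norm_min_run_rate[OF assms(1,2,4,5)]) blast
  have bigo: "(\<lambda>k. lp_hausdorff p (P k) A) \<in> O(?r)" if "norm_min_run p A P v" for P v
    by (rule bigoI[of _ \<Lambda>]) (rule eventually_mono[OF rate[OF that]], simp)
  have eps: "\<exists>K. \<forall>k\<ge>K. lp_hausdorff p (P k) A \<le> (1 + \<epsilon>) * \<Lambda> * ?r k"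
    if "norm_min_run p A P v" "0 < \<epsilon>" for P v and \<epsilon> :: real
  proof -
    have "\<Lambda> * ?r k \<le> (1 + \<epsilon>) * \<Lambda> * ?r k" for k
      using \<Lambda> that by (simp add: mult_right_mono)
    then show ?thesis
      using rate[OF that(1)] unfolding eventually_sequentially by (meson order_trans)
  qed
  show ?thesis
    using \<Lambda> bigo eps by blast
qed

end
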